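(* Let $E$ be a finite-dimensional Euclidean space and let $X, Y$ be nonempty compact convex subsets of $E$. Then $X \div Y = 0$ if and only if $Y = X$, where $X \div Y = 0$ means that the collection $X \div Y$ has the singleton set $\{0\} \subset E$ as its only element.
   Context: $\mathcal{C}(E)$ denotes the family of nonempty compact convex subsets of $E$. Sets are added in the Minkowski sense: $X + Y = \{x + y : x \in X, y \in Y\}$. For $X, Y \in \mathcal{C}(E)$, the difference $X \div Y$ is the collection of all inclusion-minimal elements of $\{ Z \in \mathcal{C}(E) : X \subset Y + Z \}$; that is, $Z \in X \div Y$ iff $Z \in \mathcal{C}(E)$, $X \subset Y + Z$, and no $Z' \in \mathcal{C}(E)$ with $Z' \subsetneq Z$ satisfies $X \subset Y + Z'$. The singleton $\{0\}$ is denoted by $0$, and a set $X \in \mathcal{C}(E)$ is identified with the collection $X \div \{0\} = \{X\}$. *)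

theory Defs
  imports "HOL-Analysis.Analysis" "HOL-Library.Set_Algebras"
begin

definition convex_bodies :: "'a::euclidean_space set set" where
  "convex_bodies = {X. X \<noteq> {} \<and> compact X \<and> convex X}"

text \<open>The sum of sets below is the Minkowski sum of \<^theory>\<open>HOL-Library.Set_Algebras\<close>.\<close>

definition minkowski_diff :: "'a::euclidean_space set \<Rightarrow> 'a set \<Rightarrow> 'a set set"
    (infixl "\<div>" 65) where
  "X \<div> Y =
     {Z \<in> convex_bodies. X \<subseteq> Y + Z \<and>
        \<not> (\<exists>Z' \<in> convex_bodies. Z' \<subset> Z \<and> X \<subseteq> Y + Z')}"

end

theory Submission
  imports Defs
begin

text \<open>Call a convex body \<open>Z\<close> admissible for \<open>X \<div> Y\<close> if \<open>X \<subseteq> Y + Z\<close>; the difference consists of the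
  minimal admissible sets.

  In the inclusion \<open>X \<subseteq> X + Z\<close> one may cancel \<open>X\<close>, which leaves \<open>0 \<in> Z\<close>: if a hyperplane
  separated \<open>Z\<close> strictly from \<open>0\<close>, its normal functional would have no minimum on the compact
  set \<open>X\<close> (\<open>zero_in_absorbed_summand\<close>). So every admissible set for \<open>X \<div> X\<close> contains the
  admissible set \<open>{0}\<close>, which is therefore the only minimal one.

  Conversely, suppose that \<open>{0}\<close> is the only minimal admissible set. It is admissible, so
  \<open>X \<subseteq> Y\<close>. As each admissible set contains a minimal one (\<open>minkowski_diff_refines\<close>, a
  compactness argument), each admissible set contains \<open>0\<close>. Now for any \<open>y \<in> Y\<close> the translate
  \<open>X - y\<close> is admissible, because the single point \<open>y\<close> of \<open>Y\<close> already carries it onto \<open>X\<close>. Hence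
  \<open>0 \<in> X - y\<close>, that is \<open>y \<in> X\<close>.\<close>

text \<open>This is the case \<open>A = {0}\<close> of the order cancellation law \<open>A + X \<subseteq> Z + X \<Longrightarrow> A \<subseteq> Z\<close> for
  convex bodies. If a functional is positive on \<open>Z\<close>, then a point of \<open>X\<close> at which it is minimal
  cannot be written as a point of \<open>X\<close> plus a point of \<open>Z\<close>.\<close>

lemma zero_in_absorbed_summand:
  fixes X Z :: "'a::euclidean_space set"
  assumes "compact X" "X \<noteq> {}" "closed Z" "convex Z" "X \<subseteq> X + Z"
  shows "0 \<in> Z"
proof (rule ccontr)
  assume "0 \<notin> Z"
  then obtain a b where ab: "0 < b" "\<And>z. z \<in> Z \<Longrightarrow> a \<bullet> z > b"
    using separating_hyperplane_closed_0[OF assms(4,3)] by metis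
  have "continuous_on X (\<lambda>x. a \<bullet> x)"
    by (intro continuous_intros)
  then obtain x where x: "x \<in> X" "\<And>x'. x' \<in> X \<Longrightarrow> a \<bullet> x \<le> a \<bullet> x'"
    using continuous_attains_inf[OF assms(1,2)] by metis
  then obtain x' z where "x' \<in> X" "z \<in> Z" "x = x' + z"
    using assms(5) by (blast elim: set_plus_elim)
  then show False
    using ab x(2)[of x'] by (force simp: inner_add_right)
qed

text \<open>A point \<open>x\<close> lies in \<open>Y + F n\<close> exactly when \<open>F n\<close> meets the compact set \<open>x - Y\<close>, so
  Cantor's intersection theorem provides one summand that serves for every \<open>n\<close>.\<close>

lemma subset_plus_Inter_nested:
  fixes X Y :: "'a::euclidean_space set" and F :: "nat \<Rightarrow> 'a set"
  assumes "compact Y" and "\<And>n. compact (F n)" and dec: "\<And>n. F (Suc n) \<subseteq> F n"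
    and sub: "\<And>n. X \<subseteq> Y + F n"
  shows "X \<subseteq> Y + \<Inter> (range F)"
proof
  fix x assume "x \<in> X"
  define G where "G n = F n \<inter> (\<lambda>y. x - y) ` Y" for n
  have "compact ((\<lambda>y. x - y) ` Y)"
    using assms(1) by (intro compact_continuous_image continuous_intros)
  then have "compact (G n)" for n
    unfolding G_def by (intro compact_Int assms)
  moreover have "G n \<noteq> {}" for n
  proof -
    obtain y z where "y \<in> Y" "z \<in> F n" "x = y + z"
      using sub[of n] \<open>x \<in> X\<close> by (blast elim: set_plus_elim)
    then have "z \<in> G n"
      unfolding G_def by force
    then show ?thesis by blast
  qed
  moreover have "G n \<subseteq> G m" if "m \<le> n" for m n
    using lift_Suc_antimono_le[of F, OF dec that] unfolding G_def by blast
  ultimately have "\<Inter> (range G) \<noteq> {}"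
    by (rule compact_nest)
  then obtain z y where z: "z \<in> \<Inter> (range F)" and "y \<in> Y" "z = x - y"
    unfolding G_def by blast
  then show "x \<in> Y + \<Inter> (range F)"
    using set_plus_intro[OF \<open>y \<in> Y\<close> z] by simp
qed

text \<open>Existence of minimal admissible sets. Closed subsets of a Euclidean space satisfy Brouwer's
  reduction principle: a property that passes to intersections of decreasing sequences has a
  minimal instance inside every instance.\<close>

lemma minkowski_diff_refines:
  fixes X Y Z :: "'a::euclidean_space set"
  assumes "compact Y" and Z: "Z \<in> convex_bodies" "X \<subseteq> Y + Z"
  obtains T where "T \<in> X \<div> Y" "T \<subseteq> Z"
proof -
  define \<phi> where "\<phi> = (\<lambda>S. S \<in> convex_bodies \<and> X \<subseteq> Y + S)"
  have closed: "closed S" if "\<phi> S" for S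
    using that by (auto simp: \<phi>_def convex_bodies_def compact_imp_closed)
  have inter: "\<phi> (\<Inter> (range F))" if F: "\<And>n. \<phi> (F n)" "\<And>n. F (Suc n) \<subseteq> F n" for F
  proof -
    have body: "compact (F n)" "convex (F n)" "F n \<noteq> {}" and sub: "X \<subseteq> Y + F n" for n
      using F(1)[of n] by (auto simp: \<phi>_def convex_bodies_def)
    have "\<Inter> (range F) \<noteq> {}"
      using body lift_Suc_antimono_le[of F, OF F(2)] by (intro compact_nest) auto
    moreover have "compact (\<Inter> (range F))"
      using body by (intro compact_Inter) auto
    moreover have "convex (\<Inter> (range F))"
      using body by (intro convex_Inter) auto
    moreover have "X \<subseteq> Y + \<Inter> (range F)"
      using assms(1) body(1) F(2) sub by (rule subset_plus_Inter_nested)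
    ultimately show ?thesis
      by (simp add: \<phi>_def convex_bodies_def)
  qed
  have "\<phi> Z"
    using Z by (simp add: \<phi>_def)
  then obtain T where T: "T \<subseteq> Z" "\<phi> T" and min: "\<And>U. U \<subseteq> Z \<Longrightarrow> closed U \<Longrightarrow> \<phi> U \<Longrightarrow> \<not> U \<subset> T"
    using Brouwer_reduction_theorem_gen[of Z \<phi>] closed inter by metis
  have "\<not> U \<subset> T" if "\<phi> U" for U
    using min[of U] closed that T(1) by blast
  then have "T \<in> X \<div> Y"
    using T(2) unfolding minkowski_diff_def \<phi>_def by blast
  then show ?thesis
    using T(1) that by blast
qed

lemma minkowski_diff_self:
  fixes X :: "'a::euclidean_space set"
  assumes "X \<in> convex_bodies"
  shows "X \<div> X = {{0}}"
proof -
  have zero: "{0} \<in> convex_bodies" "X \<subseteq> X + {0}"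
    by (simp_all add: convex_bodies_def set_plus_def)
  have "0 \<in> Z" if "Z \<in> convex_bodies" "X \<subseteq> X + Z" for Z
    using that assms by (auto simp: convex_bodies_def compact_imp_closed
        intro: zero_in_absorbed_summand)
  moreover have "Z \<noteq> {}" if "Z \<in> convex_bodies" for Z :: "'a set"
    using that by (simp add: convex_bodies_def)
  ultimately show ?thesis
    using zero unfolding minkowski_diff_def by blast
qed

theorem lemma3:
  fixes X Y :: "'a::euclidean_space set"
  assumes "X \<in> convex_bodies" and "Y \<in> convex_bodies"
  shows "X \<div> Y = {{0}} \<longleftrightarrow> Y = X"
proof
  assume eq: "X \<div> Y = {{0}}"
  then have "{0} \<in> X \<div> Y"
    by simp
  then have "X \<subseteq> Y"
    by (simp add: minkowski_diff_def set_plus_def)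
  moreover have "Y \<subseteq> X"
  proof
    fix y assume "y \<in> Y"
    define Z where "Z = (\<lambda>x. x - y) ` X"
    have "Z \<in> convex_bodies"
      using assms(1) unfolding Z_def convex_bodies_def
      by (auto intro!: compact_continuous_image continuous_intros convex_translation_subtract)
    moreover have "X \<subseteq> Y + Z"
    proof
      fix x assume "x \<in> X"
      then have "y + (x - y) \<in> Y + Z"
        using \<open>y \<in> Y\<close> unfolding Z_def by (intro set_plus_intro) auto
      then show "x \<in> Y + Z"
        by simp
    qed
    moreover have "compact Y"
      using assms(2) by (simp add: convex_bodies_def)
    ultimately obtain T where "T \<in> X \<div> Y" "T \<subseteq> Z"
      using minkowski_diff_refines by blast
    then have "0 \<in> Z"
      using eq by auto
    then show "y \<in> X"
      unfolding Z_def by auto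
  qed
  ultimately show "Y = X"
    by blast
qed (use assms minkowski_diff_self in blast)

end
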